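(* The only loop of length $2$ of the reduced Collatz function is $1 \xrightarrow{2} 1 \xrightarrow{2} 1$; that is, if $n \in \mathbb{O}_+$ satisfies $C^2(n)=n$, then $n=1$.
   Context: $\mathbb{O}_+$ denotes the set of positive odd integers. The reduced Collatz function $C : \mathbb{O}_+ \to \mathbb{O}_+$ is $C(n) = \frac{3n+1}{2^a}$, where $a$ is the largest positive integer such that $2^a \mid 3n+1$; $C^2 = C\circ C$. A loop of length $2$ is a trajectory $n \xrightarrow{a_1} C(n) \xrightarrow{a_2} n$, where the label $a_i$ over an arrow is the exponent $a$ of $2$ used in that application of $C$. *)

theory Defs
  imports "HOL-Computational_Algebra.Computational_Algebra"
begin

definition pos_odds :: "nat set" where
  "pos_odds = {n. 0 < n \<and> odd n}"

definition collatz_exp :: "nat \<Rightarrow> nat" where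
  "collatz_exp n = (GREATEST a. 0 < a \<and> 2 ^ a dvd 3 * n + 1)"

(* Only meaningful on pos_odds, where the division is exact and the exponent exists;
   see collatz_exp_maximal and reduced_collatz_in_pos_odds below. *)
definition reduced_collatz :: "nat \<Rightarrow> nat" where
  "reduced_collatz n = (3 * n + 1) div 2 ^ collatz_exp n"

(* The labelled arrow from n to m with label a. *)
definition collatz_arrow :: "nat \<Rightarrow> nat \<Rightarrow> nat \<Rightarrow> bool" where
  "collatz_arrow n a m \<longleftrightarrow> n \<in> pos_odds \<and> a = collatz_exp n \<and> m = reduced_collatz n"

(* The two vertices of a loop of length 2 are not required to be distinct. *)
definition collatz_loop2 :: "nat \<Rightarrow> nat \<Rightarrow> nat \<Rightarrow> nat \<Rightarrow> bool" where
  "collatz_loop2 n a\<^sub>1 m a\<^sub>2 \<longleftrightarrow> collatz_arrow n a\<^sub>1 m \<and> collatz_arrow m a\<^sub>2 n"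

lemma collatz_exp_maximal:
  assumes "n \<in> pos_odds"
  shows "0 < collatz_exp n" "2 ^ collatz_exp n dvd 3 * n + 1"
    and "\<And>a. 2 ^ a dvd 3 * n + 1 \<Longrightarrow> a \<le> collatz_exp n"
proof -
  let ?P = "\<lambda>a. 0 < a \<and> (2::nat) ^ a dvd 3 * n + 1"
  have P1: "?P 1" using assms by (simp add: pos_odds_def)
  have bound: "a \<le> 3 * n + 1" if "2 ^ a dvd 3 * n + 1" for a
  proof -
    have "2 ^ a \<le> 3 * n + 1" using dvd_imp_le[OF that] by simp
    with less_exp[of a] show ?thesis by linarith
  qed
  have "?P (Greatest ?P)"
    by (rule GreatestI_nat[of ?P 1 "3 * n + 1"]) (use P1 bound in auto)
  then show "0 < collatz_exp n" "2 ^ collatz_exp n dvd 3 * n + 1"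
    unfolding collatz_exp_def by auto
  fix a assume a: "(2::nat) ^ a dvd 3 * n + 1"
  show "a \<le> collatz_exp n"
  proof (cases "a = 0")
    case False
    then show ?thesis unfolding collatz_exp_def
      by (intro Greatest_le_nat[of ?P a "3 * n + 1"]) (use a bound in auto)
  qed simp
qed

lemma reduced_collatz_in_pos_odds:
  assumes "n \<in> pos_odds"
  shows "reduced_collatz n \<in> pos_odds"
proof -
  note m = collatz_exp_maximal[OF assms]
  have eq: "3 * n + 1 = 2 ^ collatz_exp n * reduced_collatz n"
    unfolding reduced_collatz_def using dvd_mult_div_cancel[OF m(2)] by simp
  have "odd (reduced_collatz n)"
  proof
    assume "even (reduced_collatz n)"
    then obtain k where "reduced_collatz n = 2 * k" by blast
    with eq have "3 * n + 1 = 2 ^ Suc (collatz_exp n) * k" by simp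
    then have "2 ^ Suc (collatz_exp n) dvd 3 * n + 1" by (rule dvdI)
    from m(3)[OF this] show False by simp
  qed
  then show ?thesis by (auto simp: pos_odds_def intro: odd_pos)
qed

end

(* If n goes to m by exponent a and m goes to n by exponent b, then multiplying
   3n + 1 = 2^a m by 3m + 1 = 2^b n gives 2^(a+b) = (3 + 1/n)(3 + 1/m), which lies in (9, 16].
   The only power of two there is 16, and it is attained only for n = m = 1. *)
theory Submission
  imports Defs
begin

text \<open>Removes \<open>div\<close>, so that each arrow becomes an exact equation and two arrows
  can be multiplied together.\<close>

lemma reduced_collatz_mult:
  assumes "n \<in> pos_odds"
  shows "2 ^ collatz_exp n * reduced_collatz n = 3 * n + 1"
  unfolding reduced_collatz_def
  using collatz_exp_maximal(2)[OF assms] by (rule dvd_mult_div_cancel)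

lemma two_cycle_equations_imp_one:
  fixes n m a b :: nat
  assumes "n > 0" "m > 0" and n: "2 ^ a * m = 3 * n + 1" and m: "2 ^ b * n = 3 * m + 1"
  shows "n = 1 \<and> m = 1"
proof -
  \<comment> \<open>The product of (3 + 1/n) and (3 + 1/m), cleared of the denominator
    \<open>n * m\<close> to stay within the naturals.\<close>
  have "2 ^ (a + b) * (n * m) = (2 ^ a * m) * (2 ^ b * n)"
    by (simp add: power_add)
  also have "\<dots> = 9 * (n * m) + 3 * n + 3 * m + 1"
    unfolding n m by (simp add: algebra_simps)
  finally have prod: "2 ^ (a + b) * (n * m) = 9 * (n * m) + 3 * n + 3 * m + 1" .
  then have "9 * (n * m) < 2 ^ (a + b) * (n * m)" by linarith
  then have gt: "9 < (2::nat) ^ (a + b)" by simp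
  \<comment> \<open>The powers of two up to 2^3 = 8 are all below 9.\<close>
  have "4 \<le> a + b"
  proof (rule ccontr)
    assume "\<not> 4 \<le> a + b"
    then have "(2::nat) ^ (a + b) \<le> 2 ^ 3" by (intro power_increasing) auto
    with gt show False by simp
  qed
  then have "(2::nat) ^ 4 \<le> 2 ^ (a + b)" by (intro power_increasing) auto
  then have "16 * (n * m) \<le> 2 ^ (a + b) * (n * m)" by (intro mult_right_mono) auto
  \<comment> \<open>These bound 3n + 3m by 6nm, so \<open>prod\<close> gives 16nm \<le> 15nm +
    1.\<close>
  moreover have "n \<le> n * m" "m \<le> n * m" using assms(1,2) by auto
  ultimately have "n * m \<le> 1" using prod by linarith
  with \<open>n \<le> n * m\<close> \<open>m \<le> n * m\<close> assms(1,2) show ?thesis by linarith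
qed

lemma collatz_two_cycle_eq_one:
  assumes n: "n \<in> pos_odds" and cycle: "reduced_collatz (reduced_collatz n) = n"
  shows "n = 1"
proof -
  have m: "reduced_collatz n \<in> pos_odds" using n by (rule reduced_collatz_in_pos_odds)
  from n m have "n > 0" "reduced_collatz n > 0" by (auto simp: pos_odds_def)
  then show ?thesis
    \<comment> \<open>Rewriting with \<open>cycle\<close> makes the second arrow end at
      \<open>n\<close> again, which closes the system of two equations.\<close>
    using two_cycle_equations_imp_one[OF _ _ reduced_collatz_mult[OF n]
        reduced_collatz_mult[OF m, unfolded cycle]] by blast
qed

lemma one_in_pos_odds: "1 \<in> pos_odds"
  by (simp add: pos_odds_def)

text \<open>Here 3 * 1 + 1 = 4 = 2^2: a divisor of 4 is at most 4, and maximality gives the other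
  bound.\<close>

lemma collatz_exp_one: "collatz_exp 1 = 2"
proof (rule antisym)
  have "(2::nat) ^ collatz_exp 1 \<le> 2 ^ 2"
    using dvd_imp_le[OF collatz_exp_maximal(2)[OF one_in_pos_odds]] by simp
  then show "collatz_exp 1 \<le> 2" by (rule power_le_imp_le_exp[rotated]) simp
  show "2 \<le> collatz_exp 1" by (rule collatz_exp_maximal(3)[OF one_in_pos_odds]) simp
qed

lemma reduced_collatz_one: "reduced_collatz 1 = 1"
  unfolding reduced_collatz_def collatz_exp_one by simp

theorem mainTheorem4:
  shows "(\<forall>n a\<^sub>1 m a\<^sub>2. collatz_loop2 n a\<^sub>1 m a\<^sub>2 \<longleftrightarrow> n = 1 \<and> a\<^sub>1 = 2 \<and> m = 1 \<and> a\<^sub>2 = 2)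
    \<and> (\<forall>n \<in> pos_odds. (reduced_collatz \<circ> reduced_collatz) n = n \<longrightarrow> n = 1)"
proof (intro conjI allI ballI impI)
  fix n a\<^sub>1 m a\<^sub>2
  show "collatz_loop2 n a\<^sub>1 m a\<^sub>2 \<longleftrightarrow> n = 1 \<and> a\<^sub>1 = 2 \<and> m = 1 \<and> a\<^sub>2 = 2"
  proof
    assume "collatz_loop2 n a\<^sub>1 m a\<^sub>2"
    then have n: "n \<in> pos_odds" and a\<^sub>1: "a\<^sub>1 = collatz_exp n" and m: "m = reduced_collatz n"
      and a\<^sub>2: "a\<^sub>2 = collatz_exp m" and cycle: "n = reduced_collatz m"
      unfolding collatz_loop2_def collatz_arrow_def by blast+
    have "n = 1"
      using collatz_two_cycle_eq_one[OF n] cycle[symmetric] unfolding m by blast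
    \<comment> \<open>The start determines the rest: 1 is a fixed point, so both labels are
      \<open>collatz_exp 1\<close>.\<close>
    then show "n = 1 \<and> a\<^sub>1 = 2 \<and> m = 1 \<and> a\<^sub>2 = 2"
      by (simp only: a\<^sub>2) (simp only: m a\<^sub>1 collatz_exp_one reduced_collatz_one simp_thms)
  next
    \<comment> \<open>Conversely, the loop at 1 really exists.\<close>
    assume "n = 1 \<and> a\<^sub>1 = 2 \<and> m = 1 \<and> a\<^sub>2 = 2"
    then show "collatz_loop2 n a\<^sub>1 m a\<^sub>2"
      unfolding collatz_loop2_def collatz_arrow_def
      by (simp only: collatz_exp_one reduced_collatz_one one_in_pos_odds simp_thms)
  qed
next
  fix n assume "n \<in> pos_odds" "(reduced_collatz \<circ> reduced_collatz) n = n"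
  then show "n = 1" using collatz_two_cycle_eq_one[of n] by simp
qed

end
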